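(* Let $q\in\mathbb{C}\setminus\{0,1\}$ and $c\in\mathbb{C}$. The functional equation $$f^{3}(z)+(\mathcal{D}_{q,c}f(z))^{3}=1$$ does not admit non-constant meromorphic solutions $f$ on $\mathbb{C}$ of finite order.
   Context: For $q\in\mathbb{C}\setminus\{0,1\}$, $c\in\mathbb{C}$ and $f$ meromorphic on $\mathbb{C}$, the Hahn difference operator is $\mathcal{D}_{q,c}f(z)=\frac{f(qz+c)-f(z)}{(q-1)z+c}$. The order of $f$ is $\rho(f)=\limsup_{r\to\infty}\frac{\log^{+}T(r,f)}{\log r}$, where $T(r,f)$ is the Nevanlinna characteristic function. *)

theory Defs
  imports "HOL-Complex_Analysis.Complex_Analysis"
begin

definition hahn_diff :: "complex \<Rightarrow> complex \<Rightarrow> (complex \<Rightarrow> complex) \<Rightarrow> complex \<Rightarrow> complex" where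
  "hahn_diff q c f z = (f (q * z + c) - f z) / ((q - 1) * z + c)"

(* The maximum with 1 is taken inside the logarithm so that log_plus 0 = 0
   independently of the value of ln outside the positive reals. *)
definition log_plus :: "real \<Rightarrow> real" where
  "log_plus x = ln (max 1 x)"

definition pole_count :: "real \<Rightarrow> (complex \<Rightarrow> complex) \<Rightarrow> nat" where
  "pole_count t f = (\<Sum>z | norm z \<le> t \<and> is_pole f z. nat (- zorder f z))"

definition proximity_fun :: "real \<Rightarrow> (complex \<Rightarrow> complex) \<Rightarrow> real" where
  "proximity_fun r f =
     1 / (2 * pi) * integral {0..2 * pi} (\<lambda>\<theta>. log_plus (norm (f (of_real r * cis \<theta>))))"

definition integrated_counting_fun :: "real \<Rightarrow> (complex \<Rightarrow> complex) \<Rightarrow> real" where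
  "integrated_counting_fun r f =
     integral {0..r} (\<lambda>t. (real (pole_count t f) - real (pole_count 0 f)) / t)
       + real (pole_count 0 f) * ln r"

definition nevanlinna_char :: "real \<Rightarrow> (complex \<Rightarrow> complex) \<Rightarrow> real" where
  "nevanlinna_char r f = proximity_fun r f + integrated_counting_fun r f"

definition growth_order :: "(complex \<Rightarrow> complex) \<Rightarrow> ereal" where
  "growth_order f = Limsup at_top (\<lambda>r. ereal (log_plus (nevanlinna_char r f) / ln r))"

(* Under meromorphic_on, the values at poles and on other discrete sets are
   arbitrary, so equality of meromorphic functions is equality off a sparse set;
   being constant has to be understood in this sense too. *)
definition constant_meromorphic :: "(complex \<Rightarrow> complex) \<Rightarrow> bool" where
  "constant_meromorphic f \<longleftrightarrow> (\<exists>a. \<forall>\<^sub>\<approx>z. f z = a)"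

end

theory Submission
  imports Defs
begin

text \<open>
  Write \<open>g\<close> for the Hahn difference of \<open>f\<close>. The pair \<open>(f, g)\<close> maps into the Fermat cubic
  \<open>x\<^sup>3 + y\<^sup>3 = 1\<close>, and the pull-back of its invariant differential is \<open>H dz\<close> with
  \<open>H = f' g - f g' = f' / g\<^sup>2\<close>, which extends to an entire function. On a disc of radius \<open>R\<close> without
  poles, Schottky's theorem bounds \<open>\<bar>H\<bar>\<close> at the centre by \<open>C / R\<close>, because the cubic minus its
  three points at infinity is hyperbolic. The functional equation spreads the poles along orbits of
  \<open>z \<mapsto> q z + c\<close>: they form a bounded set if \<open>\<bar>q\<bar> \<ge> 1\<close>, and lie on circles around the fixed
  point with radii in geometric progression if \<open>\<bar>q\<bar> < 1\<close>. Hence there are arbitrarily large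
  circles, of radius \<open>r\<close> say, at distance at least \<open>\<delta> r\<close> from all poles, so the maximum
  principle gives \<open>H = 0\<close> and \<open>f\<close> is constant.
\<close>

subsection \<open>The invariant differential on pole-free discs\<close>

text \<open>Schottky's theorem bounds \<open>t\<close> by a constant on the disc of half the radius.
  The factor \<open>norm (t 0) ^ 2\<close>, sharper than a plain bound on \<open>deriv t 0\<close>,
  later absorbs a large \<open>norm (U 0) ^ 6\<close>.\<close>

lemma deriv_bound_omits_01:
  obtains C :: real where "C \<ge> 0"
    "\<And>t. \<lbrakk>t holomorphic_on cball 0 1; norm (t 0) \<le> 1; \<And>z. z \<in> cball 0 1 \<Longrightarrow> t z \<noteq> 0 \<and> t z \<noteq> 1\<rbrakk>
      \<Longrightarrow> norm (deriv t 0) ^ 3 \<le> C * norm (t 0) ^ 2"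
proof -
  \<comment> \<open>Schottky's constant for \<open>norm (t 0) \<le> 1\<close> and the disc of radius
    \<open>1/2\<close>.\<close>
  define M where "M = exp (pi * exp (pi * (2 + 2 * 1 + 12 * (1/2) / (1 - 1/2))))"
  have M1: "M \<ge> 1" unfolding M_def by simp
  have "norm (deriv t 0) ^ 3 \<le> (27 * (2 * (M + 1)) ^ 3) * norm (t 0) ^ 2"
    if holt: "t holomorphic_on cball 0 1" and t0: "norm (t 0) \<le> 1"
      and t01: "\<And>z. z \<in> cball 0 1 \<Longrightarrow> t z \<noteq> 0 \<and> t z \<noteq> 1" for t
  proof -
    have tM: "norm (t z) \<le> M" if "norm z \<le> 1/2" for z
      using Schottky[OF holt t0, of "1/2" z] t01 that unfolding M_def by auto
    have holt': "t holomorphic_on ball 0 1"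
      using holt holomorphic_on_subset ball_subset_cball by blast
    obtain L where L: "L holomorphic_on ball 0 1" "\<And>z. z \<in> ball 0 1 \<Longrightarrow> t z = exp (L z)"
      using contractible_imp_holomorphic_log[OF holt' convex_imp_contractible] t01
      by (metis convex_ball ball_subset_cball subsetD)
    \<comment> \<open>The bound is Cauchy's estimate for the cube root \<open>k\<close> of \<open>t\<close>, as \<open>t' = 3 k\<^sup>2 k'\<close>.\<close>
    define k where "k = (\<lambda>z. exp (L z / 3))"
    have holk: "k holomorphic_on ball 0 1"
      unfolding k_def by (intro holomorphic_intros L) auto
    have tk: "t z = k z ^ 3" if "z \<in> ball 0 1" for z
      using L(2)[OF that] by (simp add: k_def flip: exp_of_nat_mult)
    have kM: "norm (k z) \<le> M" if "norm z \<le> 1/2" for z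
    proof (rule power_le_imp_le_base)
      have "norm (k z) ^ Suc 2 = norm (t z)"
        using tk[of z] that by (simp add: norm_power numeral_3_eq_3 flip: norm_mult)
      also have "\<dots> \<le> M" by (rule tM[OF that])
      also have "\<dots> \<le> M ^ Suc 2" using M1 self_le_power[of M "Suc 2"] by simp
      finally show "norm (k z) ^ Suc 2 \<le> M ^ Suc 2" .
    qed (use M1 in auto)
    \<comment> \<open>\<open>M + 1\<close> instead of \<open>M\<close>, as Cauchy's estimate asks
      for values in an open ball.\<close>
    have "norm ((deriv ^^ 1) k 0) \<le> fact 1 * (M + 1) / (1/2) ^ 1"
    proof (rule Cauchy_higher_deriv_bound)
      show "k holomorphic_on ball 0 (1/2)" by (rule holomorphic_on_subset[OF holk]) auto
      show "continuous_on (cball 0 (1/2)) k"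
        by (rule holomorphic_on_imp_continuous_on, rule holomorphic_on_subset[OF holk]) auto
      show "k w \<in> ball 0 (M + 1)" if "w \<in> ball 0 (1/2)" for w
        using kM[of w] that by auto
    qed auto
    hence dk: "norm (deriv k 0) \<le> 2 * (M + 1)" by simp
    have "(k has_field_derivative deriv k 0) (at 0)"
      using holk by (auto intro: holomorphic_derivI)
    hence "((\<lambda>z. k z ^ 3) has_field_derivative 3 * k 0 ^ 2 * deriv k 0) (at 0)"
      by (auto intro!: derivative_eq_intros)
    hence "(t has_field_derivative 3 * k 0 ^ 2 * deriv k 0) (at 0)"
      by (rule has_field_derivative_transform_within_open[of _ _ _ "ball 0 1"]) (auto simp: tk)
    hence "deriv t 0 = 3 * k 0 ^ 2 * deriv k 0" by (rule DERIV_imp_deriv)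
    hence "norm (deriv t 0) ^ 3 = 27 * norm (deriv k 0) ^ 3 * norm (t 0) ^ 2"
      by (simp add: tk norm_mult norm_power power_mult_distrib flip: power_mult)
    also have "\<dots> \<le> 27 * (2 * (M + 1)) ^ 3 * norm (t 0) ^ 2"
      by (intro mult_right_mono mult_left_mono power_mono dk) auto
    finally show ?thesis .
  qed
  thus ?thesis using M1 by (intro that[of "27 * (2 * (M + 1)) ^ 3"]) auto
qed

text \<open>These two equations are the Fermat cubic in symmetric form. \<open>U\<close>,
  \<open>V\<close> and \<open>W\<close> have no zeros, so \<open>- W / U\<close> omits 0, and it
  omits 1 because \<open>V\<close> does not vanish. Permuting the functions changes the Wronskian
  only by a sign, so their moduli at 0 may be taken in decreasing order.\<close>

lemma wronskian_bound_unit_disc: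
  obtains C :: real where "C > 0"
    "\<And>U V W. \<lbrakk>U holomorphic_on cball 0 1; V holomorphic_on cball 0 1; W holomorphic_on cball 0 1;
       \<And>z. z \<in> cball 0 1 \<Longrightarrow> U z + V z + W z = 0; \<And>z. z \<in> cball 0 1 \<Longrightarrow> U z * V z * W z = 1\<rbrakk>
      \<Longrightarrow> norm (deriv U 0 * V 0 - U 0 * deriv V 0) \<le> C"
proof -
  obtain K :: real where K: "K \<ge> 0"
    "\<And>t. \<lbrakk>t holomorphic_on cball 0 1; norm (t 0) \<le> 1; \<And>z. z \<in> cball 0 1 \<Longrightarrow> t z \<noteq> 0 \<and> t z \<noteq> 1\<rbrakk>
      \<Longrightarrow> norm (deriv t 0) ^ 3 \<le> K * norm (t 0) ^ 2"
    using deriv_bound_omits_01 by blast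
  have ordered: "norm (deriv U 0 * W 0 - U 0 * deriv W 0) \<le> 4 * K + 1"
    if hol: "U holomorphic_on cball 0 1" "V holomorphic_on cball 0 1" "W holomorphic_on cball 0 1"
      and sum0: "\<And>z. z \<in> cball 0 1 \<Longrightarrow> U z + V z + W z = 0"
      and prod1: "\<And>z. z \<in> cball 0 1 \<Longrightarrow> U z * V z * W z = 1"
      and le: "norm (V 0) \<le> norm (U 0)" "norm (W 0) \<le> norm (V 0)" for U V W
  proof -
    define t where "t = (\<lambda>z. - W z / U z)"
    have nz: "U z \<noteq> 0 \<and> V z \<noteq> 0 \<and> W z \<noteq> 0" if "z \<in> cball 0 1" for z
      using prod1[OF that] by auto
    have "t holomorphic_on cball 0 1"
      unfolding t_def by (intro holomorphic_intros hol) (use nz in auto)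
    moreover have "norm (t 0) \<le> 1"
      using le nz[of 0] by (simp add: t_def norm_divide)
    moreover have "t z \<noteq> 0 \<and> t z \<noteq> 1" if "z \<in> cball 0 1" for z
    proof -
      have "U z + V z = - W z" using sum0[OF that] by (simp only: eq_neg_iff_add_eq_0)
      hence "- W z \<noteq> U z" using nz[OF that] by (metis add_cancel_right_right)
      thus ?thesis using nz[OF that] by (auto simp: t_def field_simps)
    qed
    ultimately have tK: "norm (deriv t 0) ^ 3 \<le> K * norm (t 0) ^ 2"
      by (intro K(2))
    have sub: "ball 0 1 \<subseteq> cball (0::complex) 1" by auto
    have dU: "(U has_field_derivative deriv U 0) (at 0)" and dW: "(W has_field_derivative deriv W 0) (at 0)"
      using hol holomorphic_on_subset[OF _ sub] by (auto intro!: holomorphic_derivI[of _ "ball 0 1"])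
    have "(t has_field_derivative (deriv U 0 * W 0 - U 0 * deriv W 0) / U 0 ^ 2) (at 0)"
      unfolding t_def using nz[of 0]
      by (auto intro!: derivative_eq_intros dU dW simp: field_simps power2_eq_square)
    hence "deriv t 0 = (deriv U 0 * W 0 - U 0 * deriv W 0) / U 0 ^ 2" by (rule DERIV_imp_deriv)
    hence "deriv U 0 * W 0 - U 0 * deriv W 0 = deriv t 0 * U 0 ^ 2" using nz[of 0] by simp
    hence "norm (deriv U 0 * W 0 - U 0 * deriv W 0) ^ 3 = norm (deriv t 0) ^ 3 * norm (U 0) ^ 6"
      by (simp add: norm_mult norm_power power_mult_distrib flip: power_mult)
    also have "\<dots> \<le> K * norm (t 0) ^ 2 * norm (U 0) ^ 6"
      by (intro mult_right_mono tK) auto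
    also have "\<dots> = K * (norm (W 0) * norm (U 0) * norm (U 0)) ^ 2"
      using nz[of 0] by (simp add: t_def norm_divide field_simps)
    \<comment> \<open>As \<open>U = - V - W\<close>, the ordering gives
      \<open>norm (U 0) \<le> 2 * norm (V 0)\<close>. Trading one factor \<open>U\<close> for
      \<open>V\<close> makes the product of all three appear, which is 1.\<close>
    also have "\<dots> \<le> K * (norm (W 0) * norm (U 0) * (2 * norm (V 0))) ^ 2"
    proof (intro mult_left_mono power_mono K)
      have "norm (U 0) \<le> norm (V 0) + norm (W 0)"
        using sum0[of 0] norm_triangle_ineq[of "V 0" "W 0"]
        by (metis add.assoc add_eq_0_iff2 centre_in_cball norm_minus_cancel zero_le_one)
      thus "norm (U 0) \<le> 2 * norm (V 0)" using le by simp
    qed auto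
    also have "norm (W 0) * norm (U 0) * (2 * norm (V 0)) = 2 * norm (U 0 * V 0 * W 0)"
      by (simp add: norm_mult)
    also have "\<dots> = 2" using prod1[of 0] by simp
    finally have "norm (deriv U 0 * W 0 - U 0 * deriv W 0) ^ 3 \<le> 4 * K" by simp
    \<comment> \<open>Adding 1 makes the bound at least 1, hence at most its own cube, and cube
      roots can be taken.\<close>
    also have "\<dots> \<le> (4 * K + 1) ^ 3" using self_le_power[of "4 * K + 1" 3] K(1) by simp
    finally show ?thesis
      by (subst (asm) power_mono_iff) (use K(1) in auto)
  qed
  have "norm (deriv U 0 * V 0 - U 0 * deriv V 0) \<le> 4 * K + 1"
    if hol: "U holomorphic_on cball 0 1" "V holomorphic_on cball 0 1" "W holomorphic_on cball 0 1"
      and sum0: "\<And>z. z \<in> cball 0 1 \<Longrightarrow> U z + V z + W z = 0"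
      and prod1: "\<And>z. z \<in> cball 0 1 \<Longrightarrow> U z * V z * W z = 1" for U V W
  proof -
    have sub: "ball 0 1 \<subseteq> cball (0::complex) 1" by auto
    have dU: "(U has_field_derivative deriv U 0) (at 0)" and dV: "(V has_field_derivative deriv V 0) (at 0)"
      using hol holomorphic_on_subset[OF _ sub] by (auto intro!: holomorphic_derivI[of _ "ball 0 1"])
    have "((\<lambda>z. - U z - V z) has_field_derivative (- deriv U 0 - deriv V 0)) (at 0)"
      by (auto intro!: derivative_eq_intros dU dV)
    hence "(W has_field_derivative (- deriv U 0 - deriv V 0)) (at 0)"
      by (rule has_field_derivative_transform_within_open[of _ _ _ "ball 0 1"])
         (use sum0 in \<open>auto simp: algebra_simps add_eq_0_iff\<close>)
    hence dW: "deriv W 0 = - deriv U 0 - deriv V 0" by (rule DERIV_imp_deriv)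
    have W: "W 0 = - U 0 - V 0" using sum0[of 0] by (simp add: algebra_simps add_eq_0_iff)
    \<comment> \<open>Since \<open>W = - U - V\<close> at 0, also for derivatives, this
      antisymmetric form agrees up to sign on all pairs.\<close>
    let ?D = "\<lambda>A B. deriv A 0 * B 0 - A 0 * deriv B (0::complex) :: complex"
    have eqs: "?D U W = - ?D U V" "?D V W = ?D U V" "?D V U = - ?D U V" "?D W U = ?D U V" "?D W V = - ?D U V"
      by (simp_all add: dW W algebra_simps)
    have perm: "\<And>z. z \<in> cball 0 1 \<Longrightarrow> U z + W z + V z = 0" "\<And>z. z \<in> cball 0 1 \<Longrightarrow> U z * W z * V z = 1"
      "\<And>z. z \<in> cball 0 1 \<Longrightarrow> V z + U z + W z = 0" "\<And>z. z \<in> cball 0 1 \<Longrightarrow> V z * U z * W z = 1"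
      "\<And>z. z \<in> cball 0 1 \<Longrightarrow> V z + W z + U z = 0" "\<And>z. z \<in> cball 0 1 \<Longrightarrow> V z * W z * U z = 1"
      "\<And>z. z \<in> cball 0 1 \<Longrightarrow> W z + U z + V z = 0" "\<And>z. z \<in> cball 0 1 \<Longrightarrow> W z * U z * V z = 1"
      "\<And>z. z \<in> cball 0 1 \<Longrightarrow> W z + V z + U z = 0" "\<And>z. z \<in> cball 0 1 \<Longrightarrow> W z * V z * U z = 1"
      using sum0 prod1 by (simp_all add: ac_simps)
    have nm: "norm (?D U W) = norm (?D U V)" "norm (?D V W) = norm (?D U V)" "norm (?D V U) = norm (?D U V)" 
      "norm (?D W U) = norm (?D U V)" "norm (?D W V) = norm (?D U V)"
      unfolding eqs by (simp_all add: norm_minus_commute)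
    consider "norm (V 0) \<le> norm (U 0)" "norm (W 0) \<le> norm (V 0)"
      | "norm (W 0) \<le> norm (U 0)" "norm (V 0) \<le> norm (W 0)"
      | "norm (U 0) \<le> norm (V 0)" "norm (W 0) \<le> norm (U 0)"
      | "norm (W 0) \<le> norm (V 0)" "norm (U 0) \<le> norm (W 0)"
      | "norm (U 0) \<le> norm (W 0)" "norm (V 0) \<le> norm (U 0)"
      | "norm (V 0) \<le> norm (W 0)" "norm (U 0) \<le> norm (V 0)" by linarith
    thus ?thesis
    proof cases
      case 1 show ?thesis using ordered[OF hol sum0 prod1 1] nm by simp
    next
      case 2 show ?thesis using ordered[OF hol(1,3,2) perm(1,2) 2] nm by simp
    next
      case 3 show ?thesis using ordered[OF hol(2,1,3) perm(3,4) 3] nm by simp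
    next
      case 4 show ?thesis using ordered[OF hol(2,3,1) perm(5,6) 4] nm by simp
    next
      case 5 show ?thesis using ordered[OF hol(3,1,2) perm(7,8) 5] nm by simp
    next
      case 6 show ?thesis using ordered[OF hol(3,2,1) perm(9,10) 6] nm by simp
    qed
  qed
  thus ?thesis using K(1) by (intro that[of "4 * K + 1"]) auto
qed

text \<open>The Wronskian contains one derivative, so rescaling to the unit disc multiplies it by
  the scaling factor; this produces \<open>C / R\<close>. The linear factors of the cubic over the
  cube roots of unity play the roles of \<open>U\<close>, \<open>V\<close> and
  \<open>W\<close>.\<close>

lemma fermat_cubic_wronskian_bound:
  obtains C :: real where "C > 0"
    "\<And>f g a R. \<lbrakk>R > 0; f holomorphic_on ball a R; g holomorphic_on ball a R;
       \<And>z. z \<in> ball a R \<Longrightarrow> f z ^ 3 + g z ^ 3 = 1\<rbrakk>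
      \<Longrightarrow> norm (deriv f a * g a - f a * deriv g a) \<le> C / R"
proof -
  obtain C :: real where C: "C > 0"
    "\<And>U V W. \<lbrakk>U holomorphic_on cball 0 1; V holomorphic_on cball 0 1; W holomorphic_on cball 0 1;
       \<And>z. z \<in> cball 0 1 \<Longrightarrow> U z + V z + W z = 0; \<And>z. z \<in> cball 0 1 \<Longrightarrow> U z * V z * W z = 1\<rbrakk>
      \<Longrightarrow> norm (deriv U 0 * V 0 - U 0 * deriv V 0) \<le> C"
    using wronskian_bound_unit_disc by blast
  define w :: complex where "w = cis (2 * pi / 3)"
  have w: "w ^ 3 = 1" by (simp add: w_def Complex.DeMoivre cis_2pi flip: mult.assoc)
  have w1: "w \<noteq> 1" 
  proof
    assume "w = 1"
    hence "Re w = 1" by simp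
    thus False by (simp add: w_def cos_120)
  qed
  have "(w - 1) * (1 + w + w ^ 2) = 0" using w by (simp add: algebra_simps power2_eq_square power3_eq_cube)
  hence "1 + w + w ^ 2 = 0" using w1 by (metis mult_eq_0_iff right_minus_eq)
  hence ww: "w ^ 2 = - 1 - w" by (simp add: algebra_simps add_eq_0_iff)
  have nw: "norm w = 1" by (simp add: w_def)
  have "norm (deriv f a * g a - f a * deriv g a) \<le> (2 * C / norm (w - 1)) / R"
    if R: "R > 0" and hol: "f holomorphic_on ball a R" "g holomorphic_on ball a R"
      and fg: "\<And>z. z \<in> ball a R \<Longrightarrow> f z ^ 3 + g z ^ 3 = 1" for f g a R
  proof -
    \<comment> \<open>Half the radius, so that the closed unit disc is mapped into the open
      disc.\<close>
    define s :: complex where "s = of_real (R / 2)"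
    have s: "norm s = R / 2" "s \<noteq> 0" using R by (auto simp: s_def)
    have inb: "a + s * z \<in> ball a R" if "z \<in> cball 0 1" for z
    proof -
      have "norm (s * z) \<le> R / 2 * 1" unfolding norm_mult s(1) using that R by (intro mult_left_mono) auto
      thus ?thesis using R by (simp add: dist_norm)
    qed
    define F where "F = f \<circ> (\<lambda>z. a + s * z)"
    define G where "G = g \<circ> (\<lambda>z. a + s * z)"
    have hF: "F holomorphic_on cball 0 1" unfolding F_def
      by (intro holomorphic_on_compose_gen[OF _ hol(1)] holomorphic_intros) (use inb in auto)
    have hG: "G holomorphic_on cball 0 1" unfolding G_def
      by (intro holomorphic_on_compose_gen[OF _ hol(2)] holomorphic_intros) (use inb in auto)
    have df: "(f has_field_derivative deriv f a) (at (a + s * 0))"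
      and dg: "(g has_field_derivative deriv g a) (at (a + s * 0))"
      using hol R by (auto intro!: holomorphic_derivI[of _ "ball a R"])
    have ds: "((\<lambda>z. a + s * z) has_field_derivative s) (at 0)"
      by (auto intro!: derivative_eq_intros)
    have dF: "(F has_field_derivative s * deriv f a) (at 0)"
      and dG: "(G has_field_derivative s * deriv g a) (at 0)"
      unfolding F_def G_def using DERIV_chain[OF df ds] DERIV_chain[OF dg ds] by (simp_all add: mult.commute)
    have FG0: "F 0 = f a" "G 0 = g a" by (simp_all add: F_def G_def)
    \<comment> \<open>The linear factors of \<open>F\<^sup>3 + G\<^sup>3\<close>, scaled so that their sum vanishes.\<close>
    let ?U = "\<lambda>z. F z + G z" and ?V = "\<lambda>z. w * (F z + w * G z)" and ?W = "\<lambda>z. w ^ 2 * (F z + w ^ 2 * G z)"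
    have "norm (deriv ?U 0 * ?V 0 - ?U 0 * deriv ?V 0) \<le> C"
    proof (rule C(2))
      show "?U holomorphic_on cball 0 1" "?V holomorphic_on cball 0 1" "?W holomorphic_on cball 0 1"
        by (intro holomorphic_intros hF hG)+
      fix z :: complex assume z: "z \<in> cball 0 1"
      show "?U z + ?V z + ?W z = 0"
        using w ww by algebra
      have "F z ^ 3 + G z ^ 3 = 1" using fg[OF inb[OF z]] by (simp add: F_def G_def)
      thus "?U z * ?V z * ?W z = 1"
        using w ww by algebra
    qed
    moreover have "deriv ?U 0 = s * deriv f a + s * deriv g a"
      by (rule DERIV_imp_deriv) (auto intro!: derivative_eq_intros dF dG)
    moreover have "deriv ?V 0 = w * (s * deriv f a + w * (s * deriv g a))"
      by (rule DERIV_imp_deriv) (auto intro!: derivative_eq_intros dF dG)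
    \<comment> \<open>The linear change from \<open>F\<close>, \<open>G\<close> to
      \<open>?U\<close>, \<open>?V\<close> has determinant \<open>(w - 1) * w\<close>; the factor
      \<open>s\<close> comes from the chain rule.\<close>
    ultimately have "norm ((w - 1) * w * s * (deriv f a * g a - f a * deriv g a)) \<le> C"
      by (simp add: FG0 algebra_simps)
    hence "norm (w - 1) * (R / 2) * norm (deriv f a * g a - f a * deriv g a) \<le> C"
      by (simp add: norm_mult nw s)
    thus ?thesis using R w1 by (simp add: field_simps)
  qed
  thus ?thesis using C(1) w1 by (intro that[of "2 * C / norm (w - 1)"]) auto
qed

subsection \<open>The invariant differential as an entire function\<close>

text \<open>The part of the problem that knows only the cubic and not the shift. The behaviour of
  \<open>G\<close> at the points of \<open>P\<close> is derived from that of
  \<open>F\<close>.\<close>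

locale fermat_cubic_pair =
  fixes F G :: "complex \<Rightarrow> complex" and P :: "complex set"
  assumes P_sparse: "P sparse_in UNIV"
    and F_hol: "F holomorphic_on - P" and G_hol: "G holomorphic_on - P"
    and F_pole: "\<And>p. p \<in> P \<Longrightarrow> is_pole F p"
    and fermat: "\<And>z. z \<notin> P \<Longrightarrow> F z ^ 3 + G z ^ 3 = 1"
begin

lemma open_compl_P: "open (- P)"
  using P_sparse sparse_in_UNIV_imp_closed by blast

lemma eventually_notin_P: "eventually (\<lambda>z. z \<notin> P) (at x)"
  using P_sparse sparse_in_eventually_iff[of UNIV P] by auto

lemma connected_compl_P: "connected (- P)"
  using sparse_imp_connected[of UNIV P] P_sparse by (simp add: Compl_eq_Diff_UNIV connected_UNIV)

lemma eventually_F_nonzero: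
  assumes "p \<in> P"
  shows "eventually (\<lambda>z. F z \<noteq> 0) (at p)"
  using F_pole[OF assms] non_zero_neighbour_pole by blast

text \<open>Dividing the cubic by \<open>F ^ 3\<close> shows that \<open>(G / F) ^ 3\<close> tends
  to -1. Taking moduli avoids a choice among the cube roots of -1.\<close>

lemma quotient_norm_tendsto:
  assumes "p \<in> P"
  shows "((\<lambda>z. norm (G z / F z)) \<longlongrightarrow> 1) (at p)"
proof -
  have "((\<lambda>z. inverse (F z)) \<longlongrightarrow> 0) (at p)"
    using F_pole[OF assms] unfolding is_pole_def by (rule filterlim_compose[OF tendsto_inverse_0])
  hence "((\<lambda>z. inverse (F z) ^ 3 - 1) \<longlongrightarrow> 0 ^ 3 - 1) (at p)"
    by (intro tendsto_intros)
  moreover have "eventually (\<lambda>z. inverse (F z) ^ 3 - 1 = (G z / F z) ^ 3) (at p)"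
    using eventually_F_nonzero[OF assms] eventually_notin_P
  proof eventually_elim
    case (elim z)
    have "G z ^ 3 = 1 - F z ^ 3" using fermat[OF elim(2)] by (simp add: algebra_simps)
    thus ?case using elim(1) by (simp add: field_simps)
  qed
  ultimately have "((\<lambda>z. (G z / F z) ^ 3) \<longlongrightarrow> 0 ^ 3 - 1) (at p)"
    by (rule Lim_transform_eventually)
  hence "((\<lambda>z. root 3 (norm ((G z / F z) ^ 3))) \<longlongrightarrow> root 3 (norm (0 ^ 3 - 1 :: complex))) (at p)"
    by (intro tendsto_intros)
  thus ?thesis by (simp add: norm_power real_root_power_cancel)
qed

lemma F_deriv: "z \<notin> P \<Longrightarrow> (F has_field_derivative deriv F z) (at z)"
  and G_deriv: "z \<notin> P \<Longrightarrow> (G has_field_derivative deriv G z) (at z)"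
  using F_hol G_hol open_compl_P by (auto intro: holomorphic_derivI)

text \<open>The pull-back of the invariant differential \<open>dx / y ^ 2\<close>, written without
  division so that zeros of \<open>G\<close> cause no trouble.\<close>

definition wronskian :: "complex \<Rightarrow> complex" where
  "wronskian z = deriv F z * G z - F z * deriv G z"

lemma wronskian_hol: "wronskian holomorphic_on - P"
  unfolding wronskian_def by (intro holomorphic_intros F_hol G_hol open_compl_P)

text \<open>Differentiating the cubic replaces \<open>G ^ 2 * G'\<close> by
  \<open>- F ^ 2 * F'\<close>, so \<open>(F' * G - F * G') * G ^ 2\<close> becomes
  \<open>F' * (F ^ 3 + G ^ 3)\<close>.\<close>

lemma deriv_eq_wronskian:
  assumes "z \<notin> P"
  shows "deriv F z = wronskian z * G z ^ 2"
proof -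
  have "((\<lambda>z. F z ^ 3 + G z ^ 3) has_field_derivative
          (3 * F z ^ 2 * deriv F z + 3 * G z ^ 2 * deriv G z)) (at z)"
    using assms by (auto intro!: derivative_eq_intros F_deriv G_deriv)
  moreover have "((\<lambda>z. F z ^ 3 + G z ^ 3) has_field_derivative 0) (at z)"
    by (rule has_field_derivative_transform_within_open[of "\<lambda>_. 1" _ _ "- P"])
       (use assms open_compl_P fermat in auto)
  ultimately have "3 * F z ^ 2 * deriv F z + 3 * G z ^ 2 * deriv G z = 0"
    by (rule DERIV_unique)
  hence "F z ^ 2 * deriv F z = - (G z ^ 2 * deriv G z)"
    by algebra
  hence "wronskian z * G z ^ 2 = deriv F z * (F z ^ 3 + G z ^ 3)"
    unfolding wronskian_def by algebra
  thus ?thesis using fermat[OF assms] by simp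
qed

text \<open>
  Near a pole, \<open>wronskian = F' / G\<^sup>2 = - (1 / F)' \<cdot> (F / G)\<^sup>2\<close>, where \<open>1 / F\<close> is
  holomorphic and \<open>F / G\<close> is bounded.
\<close>
lemma wronskian_bounded_at_pole:
  assumes p: "p \<in> P"
  shows "\<exists>B. eventually (\<lambda>z. norm (wronskian z) \<le> B) (at p)"
proof -
  have "eventually (\<lambda>z. z \<notin> P \<and> F z \<noteq> 0) (at p)"
    using eventually_F_nonzero[OF p] eventually_notin_P by eventually_elim auto
  then obtain S where S: "open S" "p \<in> S" "\<And>z. z \<in> S \<Longrightarrow> z \<noteq> p \<Longrightarrow> z \<notin> P \<and> F z \<noteq> 0"
    unfolding eventually_at_topological by blast
  define \<phi> where "\<phi> = (\<lambda>z. if z = p then 0 else inverse (F z))"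
  have hol\<phi>: "\<phi> holomorphic_on S"
    unfolding \<phi>_def
  proof (rule is_pole_inverse_holomorphic)
    show "F holomorphic_on S - {p}" by (rule holomorphic_on_subset[OF F_hol]) (use S in auto)
  qed (use S F_pole[OF p] in auto)
  have d\<phi>: "deriv \<phi> z = - (deriv F z / F z ^ 2)" if "z \<in> S" "z \<noteq> p" for z
  proof (rule DERIV_imp_deriv)
    have "((\<lambda>z. inverse (F z)) has_field_derivative - (deriv F z / F z ^ 2)) (at z)"
      using S(3)[OF that] by (auto intro!: derivative_eq_intros F_deriv simp: field_simps power2_eq_square)
    thus "(\<phi> has_field_derivative - (deriv F z / F z ^ 2)) (at z)"
      by (rule has_field_derivative_transform_within_open[of _ _ _ "S - {p}"])
         (use that S in \<open>auto simp: \<phi>_def\<close>)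
  qed
  have "(deriv \<phi> \<longlongrightarrow> deriv \<phi> p) (at p)"
  proof -
    have "continuous_on S (deriv \<phi>)"
      using hol\<phi> S(1) by (intro holomorphic_on_imp_continuous_on holomorphic_deriv)
    thus ?thesis using S(1,2) by (simp add: continuous_on_eq_continuous_at isCont_def)
  qed
  hence "((\<lambda>z. norm (deriv \<phi> z) / norm (G z / F z) ^ 2) \<longlongrightarrow> norm (deriv \<phi> p) / 1 ^ 2) (at p)"
    by (intro tendsto_intros quotient_norm_tendsto p) auto
  hence "eventually (\<lambda>z. norm (deriv \<phi> z) / norm (G z / F z) ^ 2 < norm (deriv \<phi> p) + 1) (at p)"
    by (rule order_tendstoD) auto
  moreover have "eventually (\<lambda>z. norm (G z / F z) > 0) (at p)"
    using quotient_norm_tendsto[OF p] by (rule order_tendstoD) auto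
  moreover have "eventually (\<lambda>z. z \<in> S - {p}) (at p)"
    using S by (intro eventually_at_in_open) auto
  ultimately have "eventually (\<lambda>z. norm (wronskian z) \<le> norm (deriv \<phi> p) + 1) (at p)"
  proof eventually_elim
    case (elim z)
    have z: "z \<notin> P" "F z \<noteq> 0" "G z \<noteq> 0" using elim S(3)[of z] by auto
    have "norm (wronskian z) = norm (deriv \<phi> z) / norm (G z / F z) ^ 2"
      using z elim(3) by (simp add: d\<phi> deriv_eq_wronskian norm_mult norm_divide norm_power field_simps)
    thus ?case using elim(1) by simp
  qed
  thus ?thesis by blast
qed

text \<open>Boundedness near each point of \<open>P\<close> makes all singularities removable, by
  Riemann's theorem.\<close>

lemma wronskian_extends:
  "remove_sings wronskian holomorphic_on UNIV" "\<And>z. z \<notin> P \<Longrightarrow> remove_sings wronskian z = wronskian z"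
proof -
  have an: "wronskian analytic_on {z}" if "z \<notin> P" for z
    using wronskian_hol open_compl_P that analytic_at by blast
  show eq: "remove_sings wronskian z = wronskian z" if "z \<notin> P" for z
    using an[OF that] by simp
  have "remove_sings wronskian analytic_on {z}" for z
  proof (cases "z \<in> P")
    case False
    thus ?thesis using an remove_sings_analytic_on by blast
  next
    case True
    obtain S where S: "open S" "z \<in> S" "\<And>w. w \<in> S \<Longrightarrow> w \<noteq> z \<Longrightarrow> w \<notin> P"
      using eventually_notin_P[of z] unfolding eventually_at_topological by blast
    have hol: "wronskian holomorphic_on S - {z}"
      by (rule holomorphic_on_subset[OF wronskian_hol]) (use S in auto)
    then obtain h where h: "h holomorphic_on S" "\<And>w. w \<in> S - {z} \<Longrightarrow> h w = wronskian w"
      using holomorphic_on_extend_bounded[OF hol] wronskian_bounded_at_pole[OF True] S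
      by (metis interior_open)
    have "h \<midarrow>z\<rightarrow> h z"
      using h(1) S by (metis holomorphic_on_imp_continuous_on continuous_on_eq_continuous_at isCont_def)
    hence "wronskian \<midarrow>z\<rightarrow> h z"
      by (rule Lim_transform_within_open[OF _ S(1,2)]) (use h in auto)
    thus ?thesis
      using remove_sings_analytic_at isolated_singularity_at_holomorphic[OF hol S(1,2)] by blast
  qed
  hence "remove_sings wronskian analytic_on UNIV"
    using analytic_on_analytic_at by blast
  thus "remove_sings wronskian holomorphic_on UNIV"
    by (rule analytic_imp_holomorphic)
qed

text \<open>Each point of a good circle of radius \<open>r\<close> is the centre of a pole-free disc
  of radius \<open>\<delta> * r\<close>, so the extended Wronskian is at most
  \<open>C / (\<delta> * r)\<close> there, hence inside as well. Letting \<open>r\<close> grow makes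
  it vanish, and with it \<open>F'\<close>.\<close>

lemma constant_if_pole_free_annuli:
  assumes \<delta>: "\<delta> > 0"
    and annuli: "\<And>r0. \<exists>r\<ge>r0. \<forall>p\<in>P. \<delta> * r \<le> \<bar>dist z0 p - r\<bar>"
  shows "\<exists>a. \<forall>z. z \<notin> P \<longrightarrow> F z = a"
proof -
  obtain C :: real where C: "C > 0"
    "\<And>f g a R. \<lbrakk>R > 0; f holomorphic_on ball a R; g holomorphic_on ball a R;
       \<And>z. z \<in> ball a R \<Longrightarrow> f z ^ 3 + g z ^ 3 = 1\<rbrakk>
      \<Longrightarrow> norm (deriv f a * g a - f a * deriv g a) \<le> C / R"
    using fermat_cubic_wronskian_bound by blast
  let ?H = "remove_sings wronskian"
  have H0: "?H w = 0" for w
  proof (rule ccontr)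
    assume nz: "?H w \<noteq> 0"
    \<comment> \<open>The first entry puts \<open>w\<close> inside the circle; the second makes
      \<open>C / (\<delta> * r)\<close> at most half of \<open>norm (?H w)\<close>.\<close>
    define r0 where "r0 = max (dist z0 w + 1) (2 * C / (\<delta> * norm (?H w)))"
    obtain r where r: "r \<ge> r0" "\<And>p. p \<in> P \<Longrightarrow> \<delta> * r \<le> \<bar>dist z0 p - r\<bar>"
      using annuli by blast
    have r_gt: "r > dist z0 w" "r > 0" using r(1) zero_le_dist[of z0 w] unfolding r0_def by linarith+
    have "norm (?H w) \<le> C / (\<delta> * r)"
    proof (rule maximum_modulus_frontier[of ?H "ball z0 r"])
      show "?H holomorphic_on interior (ball z0 r)"
        by (rule holomorphic_on_subset[OF wronskian_extends(1)]) auto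
      show "continuous_on (closure (ball z0 r)) ?H"
        by (rule continuous_on_subset[OF holomorphic_on_imp_continuous_on[OF wronskian_extends(1)]]) auto
      show "w \<in> ball z0 r" using r_gt by auto
      fix x assume "x \<in> frontier (ball z0 r)"
      hence x: "dist z0 x = r" using r_gt by (simp add: frontier_def)
      have sub: "ball x (\<delta> * r) \<subseteq> - P"
      proof
        fix y assume y: "y \<in> ball x (\<delta> * r)"
        have "\<bar>dist z0 y - r\<bar> \<le> dist x y"
          using x dist_triangle[of z0 y x] dist_triangle[of z0 x y] by (simp add: dist_commute)
        thus "y \<in> - P" using r(2)[of y] y by auto
      qed
      have pos: "\<delta> * r > 0" using \<delta> r_gt by simp
      have "norm (deriv F x * G x - F x * deriv G x) \<le> C / (\<delta> * r)"
        by (rule C(2)[OF pos]) (use sub F_hol G_hol fermat holomorphic_on_subset in auto)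
      moreover have "x \<notin> P" using sub pos by (auto simp: subset_iff)
      ultimately show "norm (?H x) \<le> C / (\<delta> * r)"
        using wronskian_extends(2) by (simp add: wronskian_def)
    qed auto
    hence "r * (\<delta> * norm (?H w)) \<le> C" using \<delta> r_gt by (simp add: field_simps)
    moreover have "2 * C / (\<delta> * norm (?H w)) \<le> r" using r(1) by (simp add: r0_def)
    hence "2 * C \<le> r * (\<delta> * norm (?H w))" using \<delta> nz by (simp add: field_simps)
    ultimately show False using C(1) by simp
  qed
  have "F constant_on - P"
  proof (rule has_field_derivative_0_imp_constant_on[OF _ connected_compl_P open_compl_P])
    fix z assume "z \<in> - P"
    hence z: "z \<notin> P" by simp
    show "(F has_field_derivative 0) (at z)"
      using F_deriv[OF z] deriv_eq_wronskian[OF z] wronskian_extends(2)[OF z] H0[of z] by simp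
  qed
  thus ?thesis by (auto simp: constant_on_def)
qed

end

subsection \<open>Propagation of poles\<close>

text \<open>The Hahn quotient is multiplied out, so that \<open>hahn\<close> is also meaningful at
  the fixed point of the shift, where the denominator vanishes.\<close>

locale hahn_fermat = fermat_cubic_pair +
  fixes q c :: complex
  assumes q0: "q \<noteq> 0" and q1: "q \<noteq> 1"
    and hahn: "\<And>z. z \<notin> P \<Longrightarrow> q * z + c \<notin> P \<Longrightarrow> F (q * z + c) - F z = ((q - 1) * z + c) * G z"
begin

definition fixpt :: complex where "fixpt = c / (1 - q)"

text \<open>Closed form of the \<open>n\<close>-fold iterate of the shift \<open>q * z + c\<close>,
  which is multiplication by \<open>q\<close> about its fixed point.\<close>

definition iter :: "nat \<Rightarrow> complex \<Rightarrow> complex" where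
  "iter n z = fixpt + q ^ n * (z - fixpt)"

lemma iter_0 [simp]: "iter 0 z = z"
  by (simp add: iter_def)

lemma iter_Suc: "iter (Suc n) z = q * iter n z + c"
proof -
  have affine: "a + q * x * (z - a) = q * (a + x * (z - a)) + d" if "a = q * a + d" for a d x
    using that by algebra
  have "fixpt = q * fixpt + c" using q1 by (simp add: fixpt_def field_simps)
  thus ?thesis unfolding iter_def power_Suc by (rule affine)
qed

lemma displacement_eq: "(q - 1) * z + c = (q - 1) * (z - fixpt)"
  using q1 by (simp add: fixpt_def field_simps)

lemma dist_iter: "dist fixpt (iter n z) = norm q ^ n * dist fixpt z"
  by (simp add: iter_def dist_norm norm_mult norm_power norm_minus_commute)

lemma filterlim_iter: "filterlim (iter n) (at (iter n z)) (at z)"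
proof (rule filterlim_atI)
  show "eventually (\<lambda>w. iter n w \<noteq> iter n z) (at z)"
    using q0 by (auto simp: iter_def eventually_at_filter)
  show "(iter n \<longlongrightarrow> iter n z) (at z)"
    unfolding iter_def by (intro tendsto_intros)
qed

lemma eventually_iter:
  assumes "eventually Q (at (iter n z))"
  shows "eventually (\<lambda>w. Q (iter n w)) (at z)"
  using eventually_compose_filterlim[OF assms filterlim_iter] .

lemma filterlim_shift: "filterlim (\<lambda>z. q * z + c) (at (q * w + c)) (at w)"
  using filterlim_iter[of "Suc 0" w] by (simp add: iter_Suc[abs_def])

lemma eventually_shift_notin_P: "eventually (\<lambda>z. z \<notin> P \<and> q * z + c \<notin> P) (at w)"
  using eventually_notin_P eventually_compose_filterlim[OF eventually_notin_P filterlim_shift]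
  by eventually_elim auto

lemma F_tendsto: "z \<notin> P \<Longrightarrow> (F \<longlongrightarrow> F z) (at z)"
  and G_tendsto: "z \<notin> P \<Longrightarrow> (G \<longlongrightarrow> G z) (at z)"
  using F_deriv G_deriv DERIV_isCont isCont_def by blast+

text \<open>Poles propagate backwards along orbits: near a regular point \<open>w\<close>,
  \<open>F (q * z + c) = F z + ((q - 1) * z + c) * G z\<close> has a finite limit.\<close>

lemma shift_pole_imp_pole:
  assumes "q * w + c \<in> P"
  shows "w \<in> P"
proof (rule ccontr)
  assume w: "w \<notin> P"
  have "((\<lambda>z. F z + ((q - 1) * z + c) * G z) \<longlongrightarrow> F w + ((q - 1) * w + c) * G w) (at w)"
    by (intro tendsto_intros F_tendsto G_tendsto w)
  moreover have "eventually (\<lambda>z. F z + ((q - 1) * z + c) * G z = F (q * z + c)) (at w)"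
    using eventually_shift_notin_P
  proof eventually_elim
    case (elim z)
    thus ?case using hahn[of z] by (simp add: algebra_simps)
  qed
  ultimately have "((\<lambda>z. F (q * z + c)) \<longlongrightarrow> F w + ((q - 1) * w + c) * G w) (at w)"
    by (rule Lim_transform_eventually)
  moreover have "filterlim (\<lambda>z. F (q * z + c)) at_infinity (at w)"
    using F_pole[OF assms] unfolding is_pole_def by (rule filterlim_compose[OF _ filterlim_shift])
  ultimately show False
    using not_tendsto_and_filterlim_at_infinity[of "at w"] by auto
qed

text \<open>The quotient minus 1 equals \<open>(q - 1) * (z - fixpt) * (G z / F z)\<close>, and
  \<open>G / F\<close> has modulus tending to 1.\<close>

lemma shift_quotient_tendsto:
  assumes "w \<in> P"
  shows "((\<lambda>z. norm (F (q * z + c) / F z - 1)) \<longlongrightarrow> norm ((q - 1) * (w - fixpt))) (at w)"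
proof -
  have "((\<lambda>z. norm ((q - 1) * (z - fixpt)) * norm (G z / F z)) \<longlongrightarrow>
          norm ((q - 1) * (w - fixpt)) * 1) (at w)"
    by (intro tendsto_intros quotient_norm_tendsto assms)
  moreover have "eventually (\<lambda>z. norm ((q - 1) * (z - fixpt)) * norm (G z / F z) =
                    norm (F (q * z + c) / F z - 1)) (at w)"
    using eventually_shift_notin_P eventually_F_nonzero[OF assms]
  proof eventually_elim
    case (elim z)
    have "F (q * z + c) / F z - 1 = (F (q * z + c) - F z) / F z"
      using elim by (simp add: field_simps)
    also have "\<dots> = (q - 1) * (z - fixpt) * (G z / F z)"
      using hahn[of z] elim by (simp add: displacement_eq)
    finally show ?case by (simp add: norm_mult norm_divide)
  qed
  ultimately show ?thesis by (simp add: Lim_transform_eventually)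
qed

text \<open>If the next orbit point is regular, \<open>F (q * z + c) / F z\<close> tends to 0, so
  the limit in \<open>shift_quotient_tendsto\<close> must be 1.\<close>

lemma last_pole_of_orbit:
  assumes w: "w \<in> P" and "q * w + c \<notin> P"
  shows "norm (q - 1) * dist fixpt w = 1"
proof -
  have "((\<lambda>z. inverse (F z)) \<longlongrightarrow> 0) (at w)"
    using F_pole[OF w] unfolding is_pole_def by (rule filterlim_compose[OF tendsto_inverse_0])
  moreover have "((\<lambda>z. F (q * z + c)) \<longlongrightarrow> F (q * w + c)) (at w)"
    by (rule filterlim_compose[OF F_tendsto[OF assms(2)] filterlim_shift])
  ultimately have "((\<lambda>z. norm (F (q * z + c) * inverse (F z) - 1)) \<longlongrightarrow> norm (F (q * w + c) * 0 - 1)) (at w)"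
    by (intro tendsto_intros)
  hence "((\<lambda>z. norm (F (q * z + c) / F z - 1)) \<longlongrightarrow> 1) (at w)"
    by (simp add: divide_inverse)
  hence "norm ((q - 1) * (w - fixpt)) = 1"
    using shift_quotient_tendsto[OF w] by (intro tendsto_unique[of "at w"]) auto
  thus ?thesis by (simp add: norm_mult dist_norm norm_minus_commute)
qed

text \<open>A ratio at distance more than 2 from 1 has modulus more than 1.\<close>

lemma eventually_F_shift_gt:
  assumes w: "w \<in> P" and far: "norm (q - 1) * dist fixpt w > 2"
  shows "eventually (\<lambda>z. norm (F (q * z + c)) > norm (F z)) (at w)"
proof -
  have "norm ((q - 1) * (w - fixpt)) > 2"
    using far by (simp add: norm_mult dist_norm norm_minus_commute)
  hence "eventually (\<lambda>z. norm (F (q * z + c) / F z - 1) > 2) (at w)"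
    using shift_quotient_tendsto[OF w] by (intro order_tendstoD)
  thus ?thesis using eventually_F_nonzero[OF w]
  proof eventually_elim
    case (elim z)
    have "norm (F (q * z + c) / F z - 1) \<le> norm (F (q * z + c) / F z) + 1"
      using norm_triangle_ineq4[of "F (q * z + c) / F z" 1] by simp
    hence "norm (F (q * z + c) / F z) > 1" using elim by linarith
    thus ?case using elim by (simp add: norm_divide field_simps)
  qed
qed

text \<open>Orbits are periodic here. A pole too far out has only poles in its orbit, since a last
  one would lie closer; then \<open>norm (F z)\<close> would increase strictly around a
  cycle.\<close>

lemma poles_near_fixpt_if_root_of_unity:
  assumes n: "n \<ge> 1" "q ^ n = 1" and p: "p \<in> P"
  shows "norm (q - 1) * dist fixpt p \<le> 2"
proof (rule ccontr)
  assume "\<not> ?thesis"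
  hence far: "norm (q - 1) * dist fixpt p > 2" by simp
  have nq: "norm q = 1"
    using n by (metis norm_power norm_one power_eq_1_iff norm_ge_zero not_one_le_zero)
  have far_k: "norm (q - 1) * dist fixpt (iter k p) > 2" for k
    using far by (simp add: dist_iter nq)
  have P_k: "iter k p \<in> P" for k
  proof (induction k)
    case (Suc k)
    thus ?case using last_pole_of_orbit[OF Suc] far_k[of k] by (auto simp: iter_Suc)
  qed (use p in simp)
  have "eventually (\<lambda>z. norm (F (iter (Suc k) z)) > norm (F z)) (at p)" for k
  proof (induction k)
    case 0
    show ?case using eventually_F_shift_gt[OF p far] by (simp add: iter_Suc)
  next
    case (Suc k)
    have "eventually (\<lambda>z. norm (F (q * iter (Suc k) z + c)) > norm (F (iter (Suc k) z))) (at p)"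
      by (rule eventually_iter[OF eventually_F_shift_gt[OF P_k far_k]])
    with Suc show ?case
      by eventually_elim (simp add: iter_Suc[of "Suc k"])
  qed
  \<comment> \<open>\<open>iter n\<close> is the identity because \<open>q ^ n = 1\<close>.\<close>
  from this[of "n - 1"] have "eventually (\<lambda>z. norm (F z) > norm (F z)) (at p)"
    using n by (simp add: iter_def)
  thus False by simp
qed

section \<open>Location of the poles, according to the size of \<open>norm q\<close>\<close>

lemma no_bounded_injective_sequence_in_P:
  fixes x :: "nat \<Rightarrow> complex"
  assumes "inj x" "\<And>n. x n \<in> P" "\<And>n. dist fixpt (x n) \<le> B"
  shows False
proof -
  have "finite (cball fixpt B \<inter> P)"
    by (rule sparse_in_compact_finite) (use P_sparse sparse_in_subset in auto)
  moreover have "range x \<subseteq> cball fixpt B \<inter> P" using assms by auto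
  ultimately have "finite (range x)" by (rule rev_finite_subset)
  thus False using assms(1) finite_imageD by blast
qed

text \<open>The backward orbit of a pole consists of poles and never moves outwards. Unless
  \<open>q\<close> is a root of unity, it is infinite and contradicts the sparseness of
  \<open>P\<close>.\<close>

lemma poles_bounded:
  assumes q: "norm q \<ge> 1" and p: "p \<in> P"
  shows "dist fixpt p \<le> 2 / norm (q - 1)"
proof (rule ccontr)
  assume "\<not> ?thesis"
  hence far: "norm (q - 1) * dist fixpt p > 2" using q1 by (simp add: field_simps)
  hence ne: "p \<noteq> fixpt" by auto
  have not_root: "q ^ n \<noteq> 1" if "n \<ge> 1" for n
    using poles_near_fixpt_if_root_of_unity[OF that _ p] far by auto
  \<comment> \<open>The backward orbit of \<open>p\<close>.\<close>
  define x where "x = (\<lambda>n. fixpt + (p - fixpt) / q ^ n)"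
  have pow_ne: "q ^ m \<noteq> q ^ n" if "m < n" for m n
  proof
    assume "q ^ m = q ^ n"
    also have "\<dots> = q ^ m * q ^ (n - m)" using that by (simp flip: power_add)
    finally show False using not_root[of "n - m"] that q0 by simp
  qed
  have "inj x"
  proof (rule injI)
    fix m n assume "x m = x n"
    hence "(p - fixpt) / q ^ m = (p - fixpt) / q ^ n" by (simp add: x_def)
    hence "q ^ m = q ^ n" using ne q0 by (subst (asm) divide_cancel_left) auto
    thus "m = n" using pow_ne[of m n] pow_ne[of n m] by (metis linorder_neqE_nat)
  qed
  moreover have "x n \<in> P" for n
  proof (induction n)
    case (Suc n)
    have "x n = fixpt + q * (x (Suc n) - fixpt)" using q0 by (simp add: x_def)
    also have "\<dots> = q * x (Suc n) + c" using iter_Suc[of 0 "x (Suc n)"] by (simp add: iter_def)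
    finally show ?case using Suc shift_pole_imp_pole by simp
  qed (use p in \<open>simp add: x_def\<close>)
  moreover have "dist fixpt (x n) \<le> dist fixpt p" for n
  proof -
    have "dist fixpt (x n) = dist fixpt p / norm q ^ n"
      by (simp add: x_def dist_norm norm_divide norm_power norm_minus_commute)
    also have "\<dots> \<le> dist fixpt p"
      using q one_le_power[OF q, of n] mult_left_mono[of 1 "norm q ^ n" "dist fixpt p"]
      by (simp add: divide_le_eq)
    finally show ?thesis .
  qed
  ultimately show False by (rule no_bounded_injective_sequence_in_P)
qed

text \<open>The forward orbit is infinite and bounded, so it leaves \<open>P\<close>. Its last pole
  before the first exit has distance \<open>1 / norm (q - 1)\<close> from the fixed point, and going
  back \<open>n\<close> steps divides by \<open>norm q ^ n\<close>.\<close>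

lemma poles_on_geometric_circles:
  assumes q: "norm q < 1" and p: "p \<in> P" "p \<noteq> fixpt"
  shows "\<exists>n. dist fixpt p = 1 / (norm (q - 1) * norm q ^ n)"
proof -
  have "\<exists>n. iter n p \<notin> P"
  proof (rule ccontr)
    assume "\<not> ?thesis"
    hence "\<And>n. iter n p \<in> P" by blast
    moreover have "inj (\<lambda>n. iter n p)"
    proof (rule injI)
      fix m n assume "iter m p = iter n p"
      hence "q ^ m = q ^ n" using p by (simp add: iter_def)
      hence "norm q ^ m = norm q ^ n" by (metis norm_power)
      thus "m = n" using q q0 power_inject_exp'[of "norm q" m n] by simp
    qed
    moreover have "dist fixpt (iter n p) \<le> dist fixpt p" for n
      using q power_le_one[of "norm q" n] mult_right_mono[of "norm q ^ n" 1 "dist fixpt p"]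
      by (simp add: dist_iter)
    ultimately show False by (intro no_bounded_injective_sequence_in_P)
  qed
  then obtain n where n: "iter n p \<notin> P" "\<And>m. m < n \<Longrightarrow> iter m p \<in> P"
    using exists_least_iff[of "\<lambda>n. iter n p \<notin> P"] by auto
  then obtain m where m: "n = Suc m" using p by (cases n) auto
  have "norm (q - 1) * dist fixpt (iter m p) = 1"
    by (rule last_pole_of_orbit) (use n m in \<open>auto simp: iter_Suc\<close>)
  thus ?thesis using q0 q1 by (intro exI[of _ m]) (simp add: dist_iter field_simps)
qed

lemma pole_free_annuli:
  "\<exists>\<delta>>0. \<forall>r0. \<exists>r\<ge>r0. \<forall>p\<in>P. \<delta> * r \<le> \<bar>dist fixpt p - r\<bar>"
proof (cases "norm q < 1")
  case False
  \<comment> \<open>All poles lie within \<open>B\<close>, so any radius of at least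
    \<open>2 * B\<close> works with \<open>\<delta> = 1/2\<close>.\<close>
  define B where "B = 2 / norm (q - 1)"
  have "\<exists>r\<ge>r0. \<forall>p\<in>P. 1 / 2 * r \<le> \<bar>dist fixpt p - r\<bar>" for r0
  proof (intro exI[of _ "max r0 (2 * B)"] conjI ballI)
    fix p assume "p \<in> P"
    hence "dist fixpt p \<le> B" using poles_bounded False by (simp add: B_def)
    thus "1 / 2 * max r0 (2 * B) \<le> \<bar>dist fixpt p - max r0 (2 * B)\<bar>" by linarith
  qed simp
  thus ?thesis by (intro exI[of _ "1 / 2"]) simp
next
  case True
  define s where "s = sqrt (norm q)"
  have s: "0 < s" "s < 1" "s * s = norm q"
    using True q0 by (simp_all add: s_def)
  define \<rho> where "\<rho> = 1 / norm (q - 1)"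
  have \<rho>: "\<rho> > 0" using q1 by (simp add: \<rho>_def)
  have "\<exists>r\<ge>r0. \<forall>p\<in>P. (1 - s) * r \<le> \<bar>dist fixpt p - r\<bar>" for r0
  proof -
    have "inverse (norm q) > 1" using True q0 by (simp add: one_less_inverse)
    then obtain n where n: "r0 / \<rho> < inverse (norm q) ^ n" using real_arch_pow by blast
    \<comment> \<open>The geometric mean of two consecutive pole circles, whose radii are
      \<open>r * s\<close> and \<open>r / s\<close>.\<close>
    define r where "r = \<rho> / norm q ^ n / s"
    have r_pos: "r > 0" using s \<rho> q0 by (simp add: r_def)
    have "r0 \<le> \<rho> / norm q ^ n" using n \<rho> by (simp add: field_simps)
    also have "\<dots> \<le> r" using s \<rho> q0 by (simp add: r_def field_simps)
    finally have "r \<ge> r0" .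
    moreover have "(1 - s) * r \<le> \<bar>dist fixpt p - r\<bar>" if p: "p \<in> P" for p
    proof (cases "p = fixpt")
      case True
      thus ?thesis using s r_pos by simp
    next
      case False
      then obtain m where m: "dist fixpt p = \<rho> / norm q ^ m"
        using poles_on_geometric_circles[OF True p] by (auto simp: \<rho>_def)
      show ?thesis
      proof (cases "m \<le> n")
        case True
        have "norm q ^ n \<le> norm q ^ m" using True s(3) \<open>norm q < 1\<close> by (intro power_decreasing) auto
        hence "dist fixpt p \<le> \<rho> / norm q ^ n" unfolding m using \<rho> q0 by (intro divide_left_mono) auto
        also have "\<dots> = r * s" using s by (simp add: r_def)
        finally show ?thesis by (simp add: algebra_simps)
      next
        case False
        have "norm q ^ m \<le> norm q ^ Suc n" using False \<open>norm q < 1\<close> by (intro power_decreasing) auto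
        hence "\<rho> / norm q ^ Suc n \<le> dist fixpt p" unfolding m using \<rho> q0 by (intro divide_left_mono) auto
        also have "\<rho> / norm q ^ Suc n = r / s" using s by (simp add: r_def field_simps flip: s(3))
        finally have "r / s \<le> dist fixpt p" .
        \<comment> \<open>The outer gap \<open>r / s - r\<close> is at least the inner gap
          \<open>r - r * s\<close>, so \<open>1 - s\<close> serves for both.\<close>
        moreover have "(2 - s) * s \<le> 1" using zero_le_power2[of "1 - s"] by (simp add: power2_eq_square algebra_simps)
        hence "2 - s \<le> 1 / s" using s by (simp add: field_simps)
        hence "(2 - s) * r \<le> r / s" using r_pos mult_right_mono[of "2 - s" "1 / s" r] by simp
        ultimately show ?thesis by (simp add: algebra_simps)
      qed
    qed
    ultimately show ?thesis by blast
  qed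
  thus ?thesis using s by (intro exI[of _ "1 - s"]) simp
qed

lemma F_constant: "\<exists>a. \<forall>z. z \<notin> P \<longrightarrow> F z = a"
  using pole_free_annuli constant_if_pole_free_annuli by blast

end

section \<open>From a meromorphic solution to holomorphic representatives\<close>

lemma meromorphic_hahn_diff:
  assumes "f meromorphic_on UNIV"
  shows "hahn_diff q c f meromorphic_on UNIV"
proof -
  have "(\<lambda>z. f (q * z + c)) meromorphic_on UNIV"
    by (rule meromorphic_on_compose[OF assms]) (auto intro!: analytic_intros)
  thus ?thesis
    unfolding hahn_diff_def using assms by (intro meromorphic_intros)
qed

lemma tendsto_remove_sings:
  assumes "f meromorphic_on UNIV" "\<not> is_pole f z"
  shows "f \<midarrow>z\<rightarrow> remove_sings f z" "remove_sings f analytic_on {z}"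
proof -
  have *: "isolated_singularity_at f z" "not_essential f z"
    using assms(1) by (auto elim: meromorphic_onE)
  then obtain a where "f \<midarrow>z\<rightarrow> a" using assms(2) by (auto simp: not_essential_def)
  thus "f \<midarrow>z\<rightarrow> remove_sings f z" "remove_sings f analytic_on {z}"
    using remove_sings_eqI remove_sings_analytic_at[OF *(1)] by auto
qed

text \<open>\<open>g ^ 3 = 1 - f ^ 3\<close> has a finite limit. Thus the Hahn difference can have
  poles only at poles of \<open>f\<close>, and one exceptional set serves both functions.\<close>

lemma fermat_cubic_no_pole:
  fixes z :: complex
  assumes lim: "f \<midarrow>z\<rightarrow> (a :: complex)" and eq: "eventually (\<lambda>w. f w ^ 3 + g w ^ 3 = 1) (at z)"
  shows "\<not> is_pole g z"
proof
  assume "is_pole g z"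
  hence "filterlim (\<lambda>w. g w ^ 3) at_infinity (at z)"
    unfolding is_pole_def
    by (rule filterlim_compose[OF filterlim_power_at_infinity, rotated]) auto
  moreover have "((\<lambda>w. 1 - f w ^ 3) \<longlongrightarrow> 1 - a ^ 3) (at z)"
    by (intro tendsto_intros lim)
  hence "((\<lambda>w. g w ^ 3) \<longlongrightarrow> 1 - a ^ 3) (at z)"
    by (rule Lim_transform_eventually) (use eq in \<open>eventually_elim; simp add: algebra_simps\<close>)
  ultimately show False using not_tendsto_and_filterlim_at_infinity[of "at z"] by auto
qed

theorem theorem10:
  fixes q c :: complex
  assumes "q \<noteq> 0" and "q \<noteq> 1"
  shows "\<not> (\<exists>f :: complex \<Rightarrow> complex.
            f meromorphic_on UNIV \<and>
            \<not> constant_meromorphic f \<and>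
            growth_order f < \<infinity> \<and>
            (\<forall>\<^sub>\<approx>z. f z ^ 3 + hahn_diff q c f z ^ 3 = 1))"
proof safe
  fix f :: "complex \<Rightarrow> complex"
  assume mero: "f meromorphic_on UNIV" and nonconst: "\<not> constant_meromorphic f"
    and eq_cosparse: "\<forall>\<^sub>\<approx>z. f z ^ 3 + hahn_diff q c f z ^ 3 = 1"
  let ?g = "hahn_diff q c f" and ?P = "{z. is_pole f z}"
  have eq: "eventually (\<lambda>z. f z ^ 3 + ?g z ^ 3 = 1) (at x)" for x
    using eq_cosparse by (simp add: eventually_cosparse_open_eq)
  have mero_g: "?g meromorphic_on UNIV" by (rule meromorphic_hahn_diff[OF mero])
  have iso: "isolated_singularity_at f x" for x
    using mero by (auto elim: meromorphic_onE)
  have f_lim: "f \<midarrow>z\<rightarrow> remove_sings f z" "remove_sings f analytic_on {z}" if "\<not> is_pole f z" for z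
    using tendsto_remove_sings[OF mero that] by auto
  have no_pole_g: "\<not> is_pole ?g z" if "\<not> is_pole f z" for z
    using fermat_cubic_no_pole[OF f_lim(1)[OF that] eq] .
  have g_lim: "?g \<midarrow>z\<rightarrow> remove_sings ?g z" "remove_sings ?g analytic_on {z}" if "\<not> is_pole f z" for z
    using tendsto_remove_sings[OF mero_g no_pole_g[OF that]] by auto
  have sparse: "?P sparse_in UNIV"
    using meromorphic_on_imp_not_pole_cosparse[OF mero] by (simp add: eventually_cosparse)
  \<comment> \<open>The values of \<open>f\<close> on a sparse set are arbitrary. After removing
    singularities, both equations hold pointwise off the poles, as limits of equations on punctured
    neighbourhoods.\<close>
  interpret hahn_fermat "remove_sings f" "remove_sings ?g" ?P q c
  proof
    show "remove_sings f holomorphic_on - ?P" "remove_sings ?g holomorphic_on - ?P"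
      using f_lim(2) g_lim(2) analytic_on_analytic_at[of _ "- ?P"]
      by (auto intro!: analytic_imp_holomorphic)
    show "is_pole (remove_sings f) p" if "p \<in> ?P" for p
      using that iso by simp
    fix z assume "z \<notin> ?P"
    hence z: "\<not> is_pole f z" by simp
    have "((\<lambda>w. f w ^ 3 + ?g w ^ 3) \<longlongrightarrow> remove_sings f z ^ 3 + remove_sings ?g z ^ 3) (at z)"
      by (intro tendsto_intros f_lim(1) g_lim(1) z)
    moreover have "((\<lambda>w. f w ^ 3 + ?g w ^ 3) \<longlongrightarrow> 1) (at z)"
      by (rule tendsto_eventually[OF eq])
    ultimately show "remove_sings f z ^ 3 + remove_sings ?g z ^ 3 = 1"
      by (intro tendsto_unique[of "at z"]) auto
    assume "q * z + c \<notin> ?P"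
    hence qz: "\<not> is_pole f (q * z + c)" by simp
    have "filterlim (\<lambda>w. q * w + c) (at (q * z + c)) (at z)"
    proof (rule filterlim_atI)
      show "eventually (\<lambda>w. q * w + c \<noteq> q * z + c) (at z)"
        using assms by (auto simp: eventually_at_filter)
      show "((\<lambda>w. q * w + c) \<longlongrightarrow> q * z + c) (at z)" by (intro tendsto_intros)
    qed
    hence "((\<lambda>w. f (q * w + c) - f w) \<longlongrightarrow> remove_sings f (q * z + c) - remove_sings f z) (at z)"
      by (intro tendsto_intros f_lim(1) z filterlim_compose[OF f_lim(1)[OF qz]])
    moreover have "((\<lambda>w. f (q * w + c) - f w) \<longlongrightarrow> ((q - 1) * z + c) * remove_sings ?g z) (at z)"
    proof (rule Lim_transform_eventually)
      show "((\<lambda>w. ((q - 1) * w + c) * ?g w) \<longlongrightarrow> ((q - 1) * z + c) * remove_sings ?g z) (at z)"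
        by (intro tendsto_intros g_lim(1) z)
      \<comment> \<open>Excludes the zero of the denominator, where \<open>hahn_diff\<close> takes
        the default value 0 of division by zero.\<close>
      have "eventually (\<lambda>w. w \<noteq> - c / (q - 1)) (at z)"
        by (rule eventually_neq_at_within)
      thus "eventually (\<lambda>w. ((q - 1) * w + c) * ?g w = f (q * w + c) - f w) (at z)"
      proof eventually_elim
        case (elim w)
        hence "(q - 1) * w \<noteq> - c" using assms
          by (metis mult.commute nonzero_eq_divide_eq right_minus_eq)
        hence "(q - 1) * w + c \<noteq> 0" by (simp only: eq_neg_iff_add_eq_0 not_False_eq_True simp_thms)
        thus ?case by (simp add: hahn_diff_def)
      qed
    qed
    ultimately show "remove_sings f (q * z + c) - remove_sings f z = ((q - 1) * z + c) * remove_sings ?g z"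
      by (intro tendsto_unique[of "at z"]) auto
  qed (use sparse assms in auto)
  obtain a where a: "\<And>z. z \<notin> ?P \<Longrightarrow> remove_sings f z = a" using F_constant by blast
  \<comment> \<open>On small punctured discs, even around poles, \<open>f\<close> agrees with
    \<open>remove_sings f\<close>.\<close>
  have "eventually (\<lambda>z. f z = a) (at x)" for x
    using eventually_remove_sings_eq_at[OF iso] eventually_notin_P
    by eventually_elim (use a in auto)
  hence "constant_meromorphic f"
    by (auto simp: constant_meromorphic_def eventually_cosparse_open_eq)
  thus False using nonconst by blast
qed

end
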